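(* For $n\ge1$ and $0<k,j<n$, \[B(n,k,j)=(k+1)B(n-1,k,j)+(n-k)B(n-1,k-1,j)+kB(n-1,k,j-1)+(n-k+1)B(n-1,k-1,j-1),\] and for all $n\ge 0$, $0\le k,j\le n$ the boundary conditions hold: $B(n,0,j)=[j=0]$, $B(n,n,j)=[j=n]$, $B(n,k,0)=A(n,k)$, $B(n,k,n)=A(n,n-k)$. Moreover, the displayed recurrence remains true for all $n\ge1$ and $0\le j,k\le n$ under the convention that $B(n-1,k',j')=0$ whenever $j'\in\{-1,n\}$ or $k'\in\{-1,n\}$.
   Context: $\mathcal{B}_n$ is the set of signed permutations of order $n$: bijections $\sigma$ of $\{-n,\ldots,n\}$ with $\sigma(-i)=-\sigma(i)$, identified with $(0,\sigma_1,\ldots,\sigma_n)$. $\mathrm{des}(\sigma)$ is the number of $i\in\{1,\ldots,n\}$ with $\sigma_{i-1}>\sigma_i$ ($\sigma_0=0$), $\mathrm{neg}(\sigma)$ the number of $i\in\{1,\ldots,n\}$ with $\sigma_i<0$. $B(n,k,j)$ is the number of $\sigma\in\mathcal{B}_n$ with $\mathrm{des}(\sigma)=k$, $\mathrm{neg}(\sigma)=j$. $A(n,k)$ is the Eulerian number: the number of permutations $(\tau_1,\ldots,\tau_n)$ of $\{1,\ldots,n\}$ with exactly $k$ indices $i$ such that $\tau_i>\tau_{i+1}$ (with $A(0,0)=1$). $[p]$ is $1$ if $p$ is true and $0$ otherwise. *)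

theory Defs
  imports "HOL-Combinatorics.Permutations"
begin

text \<open>Signed permutations are maps on all integers that fix every point outside
  \<open>{-n..n}\<close>, so that each one is represented by exactly one function. Oddness gives
  \<open>\<sigma> 0 = 0\<close>.\<close>

definition signed_perms :: "nat \<Rightarrow> (int \<Rightarrow> int) set" where
  "signed_perms n =
     {\<sigma>. \<sigma> permutes {- int n..int n} \<and> (\<forall>i\<in>{- int n..int n}. \<sigma> (- i) = - \<sigma> i)}"

definition signed_des :: "nat \<Rightarrow> (int \<Rightarrow> int) \<Rightarrow> nat" where
  "signed_des n \<sigma> = card {i \<in> {1..int n}. \<sigma> (i - 1) > \<sigma> i}"

definition signed_neg :: "nat \<Rightarrow> (int \<Rightarrow> int) \<Rightarrow> nat" where
  "signed_neg n \<sigma> = card {i \<in> {1..int n}. \<sigma> i < 0}"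

definition B_num :: "nat \<Rightarrow> nat \<Rightarrow> nat \<Rightarrow> nat" where
  "B_num n k j = card {\<sigma> \<in> signed_perms n. signed_des n \<sigma> = k \<and> signed_neg n \<sigma> = j}"

definition A_num :: "nat \<Rightarrow> nat \<Rightarrow> nat" where
  "A_num n k = card {\<tau>. \<tau> permutes {1..n} \<and> card {i \<in> {1..<n}. \<tau> i > \<tau> (i + 1)} = k}"

text \<open>\<open>B_num\<close> with integer indices, set to zero just outside the range \<open>{0..m}\<close>.
  Only indices in \<open>{-1..m + 1}\<close> are meaningful.\<close>

definition B_ext :: "nat \<Rightarrow> int \<Rightarrow> int \<Rightarrow> nat" where
  "B_ext m k j =
     (if k \<in> {-1, int m + 1} \<or> j \<in> {-1, int m + 1} then 0 else B_num m (nat k) (nat j))"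

end

theory Submission
  imports Defs
begin

text \<open>Delete the entry of absolute value \<open>n\<close> from the word \<open>\<sigma>\<^sub>1 \<dots> \<sigma>\<^sub>n\<close>. Conversely, inserting \<open>n\<close> or
  \<open>-n\<close> into one of the gaps after \<open>\<sigma>\<^sub>0 = 0, \<sigma>\<^sub>1, \<dots>, \<sigma>\<^sub>n\<^sub>-\<^sub>1\<close> keeps the number of descents at a
  descent and raises it by one at an ascent, while in the last gap \<open>n\<close> keeps it and \<open>-n\<close> raises
  it. Counting gaps gives the recurrence, from which the values at \<open>k = 0\<close> and \<open>k = n\<close> follow by
  induction. For \<open>j = 0\<close> the word is a permutation, and for \<open>j = n\<close> negating all entries turns
  the \<open>n\<close> descents and ascents of \<open>0, \<sigma>\<^sub>1, \<dots>, \<sigma>\<^sub>n\<close> into each other.\<close>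

section \<open>Descents of words\<close>

fun descents :: "'a::linorder list \<Rightarrow> nat" where
  "descents [] = 0"
| "descents [x] = 0"
| "descents (x # y # zs) = of_bool (y < x) + descents (y # zs)"

lemma descents_append:
  "us \<noteq> [] \<Longrightarrow> vs \<noteq> [] \<Longrightarrow>
   descents (us @ vs) = descents us + of_bool (hd vs < last us) + descents vs"
proof (induction us rule: descents.induct)
  case (2 x)
  then show ?case by (cases vs) auto
qed auto

text \<open>Bridge to \<open>signed_des\<close> and \<open>A_num\<close>, which count positions.
  Here positions start at 0 and a descent is recorded at its left end.\<close>

lemma descents_eq_card:
  "descents xs = card {i. Suc i < length xs \<and> xs ! Suc i < xs ! i}"
proof (induction xs rule: descents.induct)
  case (3 x y zs)
  let ?D = "\<lambda>xs. {i. Suc i < length xs \<and> xs ! Suc i < (xs ! i :: 'a)}"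
  have eq: "?D (x # y # zs) = (if y < x then {0} else {}) \<union> Suc ` ?D (y # zs)"
    (is "_ = ?R")
  proof (rule set_eqI)
    fix i show "i \<in> ?D (x # y # zs) \<longleftrightarrow> i \<in> ?R" by (cases i) auto
  qed
  have "card ?R = of_bool (y < x) + card (Suc ` ?D (y # zs))"
    by (subst card_Un_disjoint) auto
  then show ?case by (simp only: eq descents.simps 3 card_image inj_Suc)
qed auto

text \<open>Neighbours differ, so each adjacent pair is a descent in exactly one of
  \<open>xs\<close> and its negation.\<close>

lemma descents_map_uminus:
  fixes xs :: "int list"
  assumes "distinct xs"
  shows "descents (map uminus xs) + descents xs = length xs - 1"
  using assms by (induction xs rule: descents.induct) auto

section \<open>Inserting a letter of largest absolute value\<close>

definition insert_at :: "nat \<Rightarrow> 'a \<Rightarrow> 'a list \<Rightarrow> 'a list" where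
  "insert_at p a xs = take p xs @ a # drop p xs"

lemma set_insert_at [simp]: "set (insert_at p a xs) = insert a (set xs)"
  by (metis append_take_drop_id insert_at_def list.simps(15) set_append Un_insert_right)

lemma mset_insert_at [simp]: "mset (insert_at p a xs) = add_mset a (mset xs)"
  by (metis append_take_drop_id insert_at_def mset.simps(2) mset_append union_mset_add_mset_right)

text \<open>The inserted letter is foreign to both lists, so it can be recognised in the result, and
  its place there separates the two halves uniquely.\<close>

lemma insert_at_inject:
  assumes "a \<notin> set xs" "a' \<notin> set xs" "a \<notin> set xs'" "a' \<notin> set xs'"
    and "p \<le> length xs" "p' \<le> length xs'"
    and eq: "insert_at p a xs = insert_at p' a' xs'"
  shows "p = p' \<and> a = a' \<and> xs = xs'"
proof -
  have "a \<in> set (insert_at p' a' xs')" by (simp flip: eq)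
  then have a: "a = a'" using assms by simp
  have "a \<notin> set (take p xs)" "a \<notin> set (drop p xs)"
    using assms(1) by (auto dest: in_set_takeD in_set_dropD)
  then have "take p xs = take p' xs' \<and> drop p xs = drop p' xs'"
    using eq unfolding insert_at_def a[symmetric] by (simp add: append_Cons_eq_iff)
  then show ?thesis
    using a assms(5,6) by (metis append_take_drop_id length_take min.absorb2)
qed

text \<open>In an inner gap two new pairs replace the old one, and exactly one of them is a descent
  because \<open>a\<close> lies above or below all other entries. Hence an old descent is merely
  replaced, while at an ascent one is gained. The last gap creates a single pair, a descent exactly
  for negative \<open>a\<close>.\<close>

lemma descents_insert_at:
  fixes xs :: "int list"
  assumes "\<And>x. x \<in> set (b # xs) \<Longrightarrow> \<bar>x\<bar> < N" and a: "a = N \<or> a = - N" and p: "p \<le> length xs"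
  shows "descents (b # insert_at p a xs) = descents (b # xs) +
    (if p < length xs then of_bool (\<not> (b # xs) ! Suc p < (b # xs) ! p) else of_bool (a < 0))"
proof -
  \<comment> \<open>Keeping \<open>b\<close> in the left part makes it nonempty, with last entry at
    position \<open>p\<close> of \<open>b # xs\<close>.\<close>
  define us where "us = take (Suc p) (b # xs)"
  define vs where "vs = drop p xs"
  have us: "us \<noteq> []" "last us = (b # xs) ! p" "last us \<in> set (b # xs)"
    using p by (auto simp: us_def last_conv_nth nth_Cons' min_def)
  have bound: "\<bar>last us\<bar> < N" using us(3) assms(1) by blast
  have 1: "b # xs = us @ vs" "b # insert_at p a xs = us @ a # vs"
    by (auto simp: us_def vs_def insert_at_def)
  show ?thesis
  proof (cases "p < length xs")
    case True
    then have vs: "vs \<noteq> []" "hd vs = (b # xs) ! Suc p" "hd vs \<in> set (b # xs)"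
      by (auto simp: vs_def hd_drop_conv_nth)
    have "\<bar>hd vs\<bar> < N" using vs(3) assms(1) by blast
    moreover have "descents (us @ a # vs) =
        descents us + of_bool (a < last us) + of_bool (hd vs < a) + descents vs"
      using us vs by (cases vs) (auto simp: descents_append)
    moreover have "descents (us @ vs) = descents us + of_bool (hd vs < last us) + descents vs"
      using us vs by (simp add: descents_append)
    ultimately show ?thesis
      using True a bound unfolding 1(2) by (auto simp: us(2) vs(2) 1(1)[symmetric])
  next
    case False
    then have "vs = []" by (simp add: vs_def)
    then show ?thesis
      using False a bound us unfolding 1 by (auto simp: descents_append)
  qed
qed

text \<open>The inner gaps of \<open>xs\<close> are the adjacent pairs of \<open>b # xs\<close>,
  each either a descent or not. The bound keeps the subtraction from being truncated.\<close>

lemma card_descent_positions: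
  fixes xs :: "'a::linorder list"
  shows "card {p. p < length xs \<and> (b # xs) ! Suc p < (b # xs) ! p} = descents (b # xs)"
    and "card {p. p < length xs \<and> \<not> (b # xs) ! Suc p < (b # xs) ! p} =
      length xs - descents (b # xs)"
    and "descents (b # xs) \<le> length xs"
proof -
  let ?D = "{p. p < length xs \<and> (b # xs) ! Suc p < (b # xs) ! p}"
  show 1: "card ?D = descents (b # xs)"
    unfolding descents_eq_card by (rule arg_cong[where f = card]) auto
  have "{p. p < length xs \<and> \<not> (b # xs) ! Suc p < (b # xs) ! p} = {..<length xs} - ?D"
    by auto
  then show "card {p. p < length xs \<and> \<not> (b # xs) ! Suc p < (b # xs) ! p} =
      length xs - descents (b # xs)"
    using 1 by (simp add: card_Diff_subset subset_eq)
  have "card ?D \<le> card {..<length xs}" by (rule card_mono) auto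
  with 1 show "descents (b # xs) \<le> length xs" by simp
qed

text \<open>Let \<open>d\<close> be the old number of descents. The gaps that keep \<open>d\<close>
  are those at descents, and for positive \<open>a\<close> the last one. The others lead to
  \<open>d + 1\<close>; there are \<open>length xs - d\<close> of them, and one more for negative
  \<open>a\<close>. The second summand writes this with \<open>d = k - 1\<close>.\<close>

lemma card_insert_at_descents:
  fixes xs :: "int list"
  assumes "\<And>x. x \<in> set (b # xs) \<Longrightarrow> \<bar>x\<bar> < N" and a: "a = N \<or> a = - N"
  shows "card {p \<in> {..length xs}. descents (b # insert_at p a xs) = k} =
    of_bool (descents (b # xs) = k) * (k + of_bool (0 < a)) +
    of_bool (Suc (descents (b # xs)) = k) * (length xs + of_bool (a < 0) + 1 - k)"
proof -
  let ?n = "length xs" and ?d = "descents (b # xs)"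
  let ?D = "{p. p < ?n \<and> (b # xs) ! Suc p < (b # xs) ! p}"
  let ?A = "{p. p < ?n \<and> \<not> (b # xs) ! Suc p < (b # xs) ! p}"
  have N: "0 < N" using assms(1)[of b] by auto
  with a have sgn: "a < 0 \<and> \<not> 0 < a \<or> \<not> a < 0 \<and> 0 < a" by auto
  have ins: "descents (b # insert_at p a xs) = ?d +
      (if p < ?n then of_bool (\<not> (b # xs) ! Suc p < (b # xs) ! p) else of_bool (a < 0))"
    if "p \<le> ?n" for p
    using assms(1) a that by (rule descents_insert_at)
  have le: "p \<le> ?n \<longleftrightarrow> p < ?n \<or> p = ?n" for p by auto
  have eq: "{p \<in> {..?n}. descents (b # insert_at p a xs) = k} =
      (if ?d = k then ?D \<union> (if 0 < a then {?n} else {}) else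
       if Suc ?d = k then ?A \<union> (if a < 0 then {?n} else {}) else {})"
    using sgn by (elim disjE conjE) (auto simp: ins le of_bool_def split: if_splits)
  show ?thesis
    using sgn card_descent_positions[where xs = xs and b = b] unfolding eq by (auto simp: card_insert_if)
qed

section \<open>Signed words and their recurrence\<close>

definition signed_words :: "nat \<Rightarrow> int list set" where
  "signed_words n = {xs. distinct (map abs xs) \<and> abs ` set xs = {1..int n}}"

definition neg_count :: "int list \<Rightarrow> nat" where
  "neg_count xs = length (filter (\<lambda>x. x < 0) xs)"

lemma neg_count_insert_at: "neg_count (insert_at p a xs) = of_bool (a < 0) + neg_count xs"
proof -
  have "mset (filter (\<lambda>x. x < 0) (insert_at p a xs)) = mset (filter (\<lambda>x. x < 0) (a # xs))"
    unfolding mset_filter by simp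
  from arg_cong[OF this, of size, unfolded size_mset] show ?thesis by (simp add: neg_count_def)
qed

lemma length_signed_words: "xs \<in> signed_words n \<Longrightarrow> length xs = n"
  by (metis (mono_tags, lifting) signed_words_def mem_Collect_eq distinct_card length_map
      set_map card_atLeastAtMost_int diff_add_cancel nat_int add_diff_cancel_right')

lemma abs_signed_words: "xs \<in> signed_words n \<Longrightarrow> x \<in> set xs \<Longrightarrow> 1 \<le> \<bar>x\<bar> \<and> \<bar>x\<bar> \<le> int n"
  unfolding signed_words_def by (metis (mono_tags, lifting) atLeastAtMost_iff image_eqI mem_Collect_eq)

lemma finite_signed_words: "finite (signed_words n)"
proof (rule finite_subset)
  show "signed_words n \<subseteq> {xs. set xs \<subseteq> {- int n..int n} \<and> length xs = n}"
    by (auto simp: length_signed_words) (drule (1) abs_signed_words, linarith)+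
qed (simp add: finite_lists_length_eq)

text \<open>The inverse deletes the only entry of absolute value \<open>n + 1\<close>. A word of
  length \<open>n\<close> has the \<open>n + 1\<close> gaps \<open>{..n}\<close>, including the one
  at the end.\<close>

lemma bij_betw_insert_at_signed_words:
  "bij_betw (\<lambda>(xs, a, p). insert_at p a xs)
     (signed_words n \<times> {int n + 1, - int n - 1} \<times> {..n}) (signed_words (Suc n))"
proof (rule bij_betw_imageI)
  show "inj_on (\<lambda>(xs, a, p). insert_at p a xs)
     (signed_words n \<times> {int n + 1, - int n - 1} \<times> {..n})"
  proof -
    have notin: "b \<notin> set ys" if "ys \<in> signed_words n" "b \<in> {int n + 1, - int n - 1}" for b ys
      using abs_signed_words[of ys n b] that by auto
    have "xs = xs' \<and> a = a' \<and> p = p'"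
      if "xs \<in> signed_words n" "a \<in> {int n + 1, - int n - 1}" "p \<in> {..n}"
        "xs' \<in> signed_words n" "a' \<in> {int n + 1, - int n - 1}" "p' \<in> {..n}"
        "insert_at p a xs = insert_at p' a' xs'" for xs a p xs' a' p'
      using insert_at_inject[of a xs a' xs' p p'] notin that by (simp add: length_signed_words)
    then show ?thesis by (intro inj_onI) (unfold mem_Times_iff case_prod_unfold prod_eq_iff, metis)
  qed
  \<comment> \<open>One direction shows that insertion stays among signed words, the other that
    deletion does.\<close>
  have iff: "insert_at p a xs \<in> signed_words (Suc n) \<longleftrightarrow> xs \<in> signed_words n"
    if "\<bar>a\<bar> = int n + 1" for p a xs
  proof -
    have "mset (map abs (insert_at p a xs)) = mset (map abs (a # xs))" by simp
    then have "distinct (map abs (insert_at p a xs)) \<longleftrightarrow> distinct (map abs (a # xs))"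
      by (rule mset_eq_imp_distinct_iff)
    then have 1: "distinct (map abs (insert_at p a xs)) \<longleftrightarrow>
        int n + 1 \<notin> abs ` set xs \<and> distinct (map abs xs)"
      by (simp add: that)
    have 2: "abs ` set (insert_at p a xs) = insert (int n + 1) (abs ` set xs)"
      by (simp add: that)
    have 3: "{1..int (Suc n)} = insert (int n + 1) {1..int n}" "int n + 1 \<notin> {1..int n}" by auto
    \<comment> \<open>The value \<open>n + 1\<close> is added to two sets that do not contain it, so
      it cancels from the equation.\<close>
    show ?thesis
      unfolding signed_words_def mem_Collect_eq 1 2 3(1) using 3(2) by (metis insert_ident)
  qed
  show "(\<lambda>(xs, a, p). insert_at p a xs) ` (signed_words n \<times> {int n + 1, - int n - 1} \<times> {..n}) =
    signed_words (Suc n)"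
  proof (intro equalityI subsetI)
    fix ys assume "ys \<in> (\<lambda>(xs, a, p). insert_at p a xs) `
      (signed_words n \<times> {int n + 1, - int n - 1} \<times> {..n})"
    then show "ys \<in> signed_words (Suc n)" by (auto simp: iff)
  next
    fix ys assume ys: "ys \<in> signed_words (Suc n)"
    then have "int n + 1 \<in> abs ` set ys" by (simp add: signed_words_def)
    then obtain a where a: "a \<in> set ys" "\<bar>a\<bar> = int n + 1" by auto
    then obtain us vs where split: "ys = us @ a # vs" by (meson split_list)
    then have ins: "ys = insert_at (length us) a (us @ vs)" by (simp add: insert_at_def)
    with ys iff a have w: "us @ vs \<in> signed_words n" by simp
    moreover have "length us \<le> n" using length_signed_words[OF w] by simp
    moreover have "a \<in> {int n + 1, - int n - 1}" using a by auto
    ultimately show "ys \<in> (\<lambda>(xs, a, p). insert_at p a xs) `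
      (signed_words n \<times> {int n + 1, - int n - 1} \<times> {..n})"
      using ins by (intro image_eqI[of _ _ "(us @ vs, a, length us)"]) auto
  qed
qed

text \<open>The prepended 0 stands for the value \<open>\<sigma> 0\<close>, which the words
  themselves omit.\<close>

definition word_count :: "nat \<Rightarrow> nat \<Rightarrow> nat \<Rightarrow> nat" where
  "word_count n k j = card {xs \<in> signed_words n. descents (0 # xs) = k \<and> neg_count xs = j}"

lemma card_filter_eq_sum: "finite A \<Longrightarrow> card {x \<in> A. P x} = (\<Sum>x\<in>A. of_bool (P x))"
  by (simp add: Int_def)

lemma word_count_0: "word_count 0 k j = of_bool (k = 0 \<and> j = 0)"
proof -
  have "{xs \<in> signed_words 0. descents (0 # xs) = k \<and> neg_count xs = j} =
      (if k = 0 \<and> j = 0 then {[]} else {})"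
    by (auto simp: signed_words_def neg_count_def)
  then show ?thesis by (simp add: word_count_def)
qed

text \<open>Each coefficient is a number of gaps. The terms with \<open>j\<close> come from
  inserting \<open>n + 1\<close>, those with \<open>j - 1\<close> from inserting its negative. The
  case distinctions stand for zero at index -1, so no bounds on \<open>k\<close> and
  \<open>j\<close> are imposed.\<close>

lemma word_count_Suc:
  "word_count (Suc n) k j =
     (k + 1) * word_count n k j
   + (if k = 0 then 0 else (Suc n - k) * word_count n (k - 1) j)
   + (if j = 0 then 0 else k * word_count n k (j - 1))
   + (if k = 0 \<or> j = 0 then 0 else (Suc n - k + 1) * word_count n (k - 1) (j - 1))"
proof -
  let ?W = "signed_words n" and ?N = "int n + 1"
  let ?d = "\<lambda>xs. descents (0 # xs :: int list)"
  let ?P = "\<lambda>k' j' xs. of_bool (?d xs = k' \<and> neg_count xs = j') :: nat"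
  let ?R = "\<lambda>xs. (k + 1) * ?P k j xs
      + (if k = 0 then 0 else (Suc n - k) * ?P (k - 1) j xs)
      + (if j = 0 then 0 else k * ?P k (j - 1) xs)
      + (if k = 0 \<or> j = 0 then 0 else (Suc n - k + 1) * ?P (k - 1) (j - 1) xs)"
  let ?Q = "\<lambda>xs. of_bool (?d xs = k \<and> neg_count xs = j) :: nat"
  have "word_count (Suc n) k j = (\<Sum>xs\<in>signed_words (Suc n). ?Q xs)"
    unfolding word_count_def by (rule card_filter_eq_sum) (rule finite_signed_words)
  also have "\<dots> = (\<Sum>(xs, a, p) \<in> ?W \<times> {?N, - int n - 1} \<times> {..n}. ?Q (insert_at p a xs))"
    by (subst sum.reindex_bij_betw[OF bij_betw_insert_at_signed_words, symmetric])
      (simp add: case_prod_unfold)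
  also have "\<dots> = (\<Sum>xs\<in>?W. \<Sum>a\<in>{?N, - int n - 1}. \<Sum>p\<le>n. ?Q (insert_at p a xs))"
    by (simp only: sum.cartesian_product)
  also have "\<dots> = (\<Sum>xs\<in>?W. ?R xs)"
  proof (rule sum.cong[OF refl])
    fix xs assume xs: "xs \<in> ?W"
    have len: "length xs = n" using xs by (rule length_signed_words)
    have bound: "\<bar>x\<bar> < ?N" if "x \<in> set (0 # xs)" for x
      using that abs_signed_words[OF xs] by force
    have inner: "(\<Sum>p\<le>n. ?Q (insert_at p a xs)) = of_bool (of_bool (a < 0) + neg_count xs = j) *
        (of_bool (?d xs = k) * (k + of_bool (0 < a)) +
         of_bool (Suc (?d xs) = k) * (n + of_bool (a < 0) + 1 - k))"
      if "a = ?N \<or> a = - ?N" for a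
    proof -
      \<comment> \<open>The number of negative entries does not depend on the gap, so its indicator
        factors out of the sum.\<close>
      have "(\<Sum>p\<le>n. ?Q (insert_at p a xs)) = of_bool (of_bool (a < 0) + neg_count xs = j) *
          card {p \<in> {..n}. descents (0 # insert_at p a xs) = k}"
        by (subst card_filter_eq_sum)
          (simp_all add: neg_count_insert_at sum_distrib_left of_bool_conj mult.commute
            del: sum_of_bool_eq sum_of_bool_mult_eq sum_mult_of_bool_eq)
      moreover have "card {p \<in> {..length xs}. descents (0 # insert_at p a xs) = k} =
          of_bool (?d xs = k) * (k + of_bool (0 < a)) +
          of_bool (Suc (?d xs) = k) * (length xs + of_bool (a < 0) + 1 - k)"
        using bound that by (rule card_insert_at_descents)
      ultimately show ?thesis by (simp only: len)
    qed
    have "(\<Sum>a\<in>{?N, - int n - 1}. \<Sum>p\<le>n. ?Q (insert_at p a xs)) =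
        (\<Sum>p\<le>n. ?Q (insert_at p ?N xs)) + (\<Sum>p\<le>n. ?Q (insert_at p (- ?N) xs))"
      by simp
    also have "\<dots> = ?R xs"
      \<comment> \<open>A word has at most \<open>n\<close> descents, so
        \<open>Suc (?d xs) = k\<close> forces \<open>k \<le> Suc n\<close>, and
        \<open>n + 1 + 1 - k\<close> agrees with \<open>Suc n - k + 1\<close>.\<close>
      using card_descent_positions(3)[of 0 xs] len
      by (subst (1 2) inner) (cases k; cases j; auto simp: Suc_diff_le)+
    finally show "(\<Sum>a\<in>{?N, - int n - 1}. \<Sum>p\<le>n. ?Q (insert_at p a xs)) = ?R xs" .
  qed
  also have "\<dots> = (k + 1) * word_count n k j
   + (if k = 0 then 0 else (Suc n - k) * word_count n (k - 1) j)
   + (if j = 0 then 0 else k * word_count n k (j - 1))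
   + (if k = 0 \<or> j = 0 then 0 else (Suc n - k + 1) * word_count n (k - 1) (j - 1))"
    unfolding word_count_def card_filter_eq_sum[OF finite_signed_words]
    by (simp add: sum.distrib sum_distrib_left del: sum_of_bool_eq sum_of_bool_mult_eq sum_mult_of_bool_eq)
  finally show ?thesis .
qed

text \<open>If an index is out of range for \<open>Suc n\<close>, then all four terms of the
  recurrence are out of range for \<open>n\<close>.\<close>

lemma word_count_eq_0: "n < k \<or> n < j \<Longrightarrow> word_count n k j = 0"
proof (induction n arbitrary: k j)
  case (Suc n)
  then have "n < k \<or> n < j" "n < k - 1 \<or> n < j" "n < k \<or> n < j - 1" "n < k - 1 \<or> n < j - 1"
    by auto
  then show ?case using Suc.prems by (simp add: word_count_Suc Suc.IH)
qed (auto simp: word_count_0)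

text \<open>At \<open>k = 0\<close> the recurrence leaves only \<open>word_count n 0 j\<close>, with
  coefficient 1.\<close>

lemma word_count_no_descents: "word_count n 0 j = of_bool (j = 0)"
  by (induction n arbitrary: j) (auto simp: word_count_0 word_count_Suc)

text \<open>At \<open>k = Suc n\<close> only the last term survives, again with coefficient 1, so
  both indices drop by one together.\<close>

lemma word_count_all_descents: "word_count n n j = of_bool (j = n)"
  by (induction n arbitrary: j) (auto simp: word_count_0 word_count_Suc word_count_eq_0)

section \<open>Signed permutations as words\<close>

text \<open>Shifts list positions to arguments of \<open>f\<close> and records a descent at its
  right end, as \<open>signed_des\<close> does.\<close>

lemma descents_map_upt:
  "descents (map f [a..<b]) = card {i \<in> {Suc a..<b}. f i < f (i - 1)}"
proof -
  have "{i \<in> {Suc a..<b}. f i < f (i - 1)} =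
      (\<lambda>i. Suc (a + i)) ` {i. Suc i < length (map f [a..<b]) \<and>
        map f [a..<b] ! Suc i < map f [a..<b] ! i}" (is "?L = ?g ` ?R")
  proof (intro equalityI subsetI)
    fix i assume "i \<in> ?L"
    then show "i \<in> ?g ` ?R" by (intro image_eqI[of _ _ "i - Suc a"]) auto
  qed auto
  moreover have "inj_on ?g ?R" by (rule inj_onI) simp
  ultimately show ?thesis unfolding descents_eq_card by (simp add: card_image)
qed

definition word_of :: "nat \<Rightarrow> (int \<Rightarrow> int) \<Rightarrow> int list" where
  "word_of n \<sigma> = map (\<lambda>i. \<sigma> (int i)) [1..<Suc n]"

lemma card_int_interval:
  "card {i \<in> {1..int n}. P i} = card {i \<in> {1..<Suc n}. P (int i)}"
proof -
  have "{i \<in> {1..int n}. P i} = int ` {i \<in> {1..<Suc n}. P (int i)}"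
    (is "?L = int ` ?R")
  proof (intro equalityI subsetI)
    fix i assume "i \<in> ?L"
    then show "i \<in> int ` ?R" by (intro image_eqI[of _ _ "nat i"]) auto
  qed auto
  then show ?thesis by (simp add: card_image)
qed

text \<open>Oddness extends to all integers because points outside the symmetric interval are
  fixed.\<close>

lemma signed_permsD:
  assumes "\<sigma> \<in> signed_perms n"
  shows "\<sigma> permutes {- int n..int n}" "\<sigma> (- i) = - \<sigma> i" "\<sigma> 0 = 0"
proof -
  show p: "\<sigma> permutes {- int n..int n}" using assms by (simp add: signed_perms_def)
  show odd: "\<sigma> (- i) = - \<sigma> i" for i
  proof (cases "i \<in> {- int n..int n}")
    case False
    then have "- i \<notin> {- int n..int n}" by auto
    with False p show ?thesis by (simp add: permutes_not_in)
  qed (use assms in \<open>simp add: signed_perms_def\<close>)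
  show "\<sigma> 0 = 0" using odd[of 0] by simp
qed

lemma signed_des_word_of:
  assumes "\<sigma> \<in> signed_perms n"
  shows "signed_des n \<sigma> = descents (0 # word_of n \<sigma>)"
proof -
  \<comment> \<open>Since \<open>\<sigma> 0 = 0\<close>, the leading 0 is itself a value of
    \<open>\<sigma>\<close>.\<close>
  have "0 # word_of n \<sigma> = map (\<lambda>i. \<sigma> (int i)) [0..<Suc n]"
    unfolding word_of_def using signed_permsD(3)[OF assms] by (subst (2) upt_conv_Cons) auto
  moreover have "{i \<in> {1..<Suc n}. \<sigma> (int i) < \<sigma> (int i - 1)} =
      {i \<in> {Suc 0..<Suc n}. \<sigma> (int i) < \<sigma> (int (i - 1))}"
    by (auto simp: of_nat_diff)
  ultimately show ?thesis
    by (simp only: signed_des_def descents_map_upt card_int_interval)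
qed

lemma signed_neg_word_of: "signed_neg n \<sigma> = neg_count (word_of n \<sigma>)"
proof -
  have "neg_count (word_of n \<sigma>) = length (filter (\<lambda>i. \<sigma> (int i) < 0) [1..<Suc n])"
    by (simp add: neg_count_def word_of_def filter_map o_def del: upt_Suc)
  also have "\<dots> = card (set (filter (\<lambda>i. \<sigma> (int i) < 0) [1..<Suc n]))"
    by (rule distinct_card[symmetric]) simp
  finally show ?thesis by (simp only: signed_neg_def card_int_interval set_filter set_upt)
qed

text \<open>Oddness and the fixed points determine \<open>\<sigma>\<close> from its values on
  \<open>1..n\<close>, and every signed word extends in this way.\<close>

lemma bij_betw_word_of: "bij_betw (word_of n) (signed_perms n) (signed_words n)"
proof (rule bij_betw_imageI)
  let ?I = "{- int n..int n}"
  show "inj_on (word_of n) (signed_perms n)"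
  proof (rule inj_onI, rule ext)
    fix \<sigma> \<tau> i assume *: "\<sigma> \<in> signed_perms n" "\<tau> \<in> signed_perms n" "word_of n \<sigma> = word_of n \<tau>"
    have pos: "\<sigma> j = \<tau> j" if "1 \<le> j" "j \<le> int n" for j
    proof -
      have "nat j \<in> set [1..<Suc n]" using that by (simp del: upt_Suc) linarith
      with *(3) have "\<sigma> (int (nat j)) = \<tau> (int (nat j))"
        unfolding word_of_def map_eq_conv by blast
      with that show ?thesis by simp
    qed
    consider "i \<notin> ?I" | "1 \<le> i \<and> i \<le> int n" | "i = 0" | "1 \<le> - i \<and> - i \<le> int n" by force
    then show "\<sigma> i = \<tau> i"
    proof cases
      case 1
      then show ?thesis using * by (metis permutes_not_in signed_permsD(1))
    next
      case 4
      then show ?thesis using pos[of "- i"] signed_permsD(2) * by (metis minus_minus)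
    qed (use pos signed_permsD(3)[OF *(1)] signed_permsD(3)[OF *(2)] in auto)
  qed
  show "word_of n ` signed_perms n = signed_words n"
  proof (intro equalityI subsetI)
    fix xs assume "xs \<in> word_of n ` signed_perms n"
    then obtain \<sigma> where \<sigma>: "\<sigma> \<in> signed_perms n" and xs: "xs = word_of n \<sigma>" by auto
    note perm = signed_permsD(1)[OF \<sigma>] and odd = signed_permsD(2)[OF \<sigma>]
    have inj: "\<sigma> i = \<sigma> j \<longleftrightarrow> i = j" for i j
      using permutes_inj[OF perm] by (auto dest: injD)
    \<comment> \<open>Equal absolute values mean that \<open>\<sigma>\<close> agrees at
      \<open>i\<close> and \<open>j\<close> or at \<open>i\<close> and \<open>-j\<close>; for
      natural numbers either case gives \<open>i = j\<close>.\<close>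
    have inj': "\<bar>\<sigma> (int i)\<bar> = \<bar>\<sigma> (int j)\<bar> \<longleftrightarrow> i = j" for i j
    proof -
      have "\<bar>\<sigma> (int i)\<bar> = \<bar>\<sigma> (int j)\<bar> \<longleftrightarrow> \<sigma> (int i) = \<sigma> (int j) \<or> \<sigma> (int i) = \<sigma> (- int j)"
        by (auto simp: abs_eq_iff odd)
      then show ?thesis unfolding inj by auto
    qed
    have dist: "distinct (map abs xs)"
      unfolding xs word_of_def map_map distinct_map by (auto simp: inj' intro!: inj_onI)
    have "abs ` set xs \<subseteq> {1..int n}"
    proof clarify
      fix x assume "x \<in> set xs"
      then obtain i where i: "i \<in> {1..n}" "x = \<sigma> (int i)"
        unfolding xs word_of_def set_map set_upt atLeastLessThanSuc_atLeastAtMost by blast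
      then have "x \<in> ?I" using permutes_in_image[OF perm, of "int i"] by auto
      moreover have "x \<noteq> 0" using inj[of "int i" 0] i signed_permsD(3)[OF \<sigma>] by auto
      ultimately show "\<bar>x\<bar> \<in> {1..int n}" by auto
    qed
    moreover have "card (abs ` set xs) = n"
      using distinct_card[OF dist] by (simp add: xs word_of_def image_image del: upt_Suc)
    ultimately have "abs ` set xs = {1..int n}" by (intro card_subset_eq) auto
    with dist show "xs \<in> signed_words n" by (simp add: signed_words_def)
  next
    fix xs assume xs: "xs \<in> signed_words n"
    \<comment> \<open>The odd extension of \<open>xs\<close>; the argument 1 reads list position
      0.\<close>
    define \<sigma> where "\<sigma> i = (if i \<notin> ?I \<or> i = 0 then i else if 0 < i then xs ! (nat i - 1)
      else - xs ! (nat (- i) - 1))" for i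
    note len = length_signed_words[OF xs]
    have odd: "\<sigma> (- i) = - \<sigma> i" for i by (auto simp: \<sigma>_def)
    have range: "1 \<le> \<bar>\<sigma> i\<bar> \<and> \<bar>\<sigma> i\<bar> \<le> int n" if "i \<in> ?I" "i \<noteq> 0" for i
    proof -
      have "1 \<le> \<bar>xs ! m\<bar> \<and> \<bar>xs ! m\<bar> \<le> int n" if "m < n" for m
        using abs_signed_words[OF xs] that len by simp
      moreover have "nat i - 1 < n" "nat (- i) - 1 < n" using that by auto
      ultimately show ?thesis using that by (auto simp: \<sigma>_def)
    qed
    have zero: "\<sigma> 0 = 0" by (simp add: \<sigma>_def)
    have pos: "i = j" if "0 < i" "0 < j" "i \<in> ?I" "j \<in> ?I" "\<bar>\<sigma> i\<bar> = \<bar>\<sigma> j\<bar>" for i j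
    proof -
      have "map abs xs ! (nat i - 1) = map abs xs ! (nat j - 1)"
        using that len by (auto simp: \<sigma>_def)
      moreover have "nat i - 1 < length (map abs xs)" "nat j - 1 < length (map abs xs)"
        using that len by auto
      ultimately have "nat i - 1 = nat j - 1"
        using xs by (auto simp: signed_words_def nth_eq_iff_index_eq simp del: nth_map length_map)
      with that show ?thesis by auto
    qed
    have "inj_on \<sigma> ?I"
    proof (rule inj_onI)
      fix i j assume ij: "i \<in> ?I" "j \<in> ?I" "\<sigma> i = \<sigma> j"
      have abs_\<sigma>: "\<bar>\<sigma> \<bar>l\<bar>\<bar> = \<bar>\<sigma> l\<bar>" for l by (cases "0 \<le> l") (auto simp: odd)
      show "i = j"
      proof (cases "i = 0 \<or> j = 0")
        case True
        then show ?thesis using ij range zero by fastforce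
      next
        case False
        then have "\<bar>i\<bar> = \<bar>j\<bar>" using ij abs_\<sigma> by - (rule pos, auto)
        \<comment> \<open>Otherwise \<open>\<sigma> j\<close> would equal its own negative and
          vanish, against \<open>range\<close>.\<close>
        moreover have "i \<noteq> - j" using odd[of j] range[of j] False ij by auto
        ultimately show ?thesis by linarith
      qed
    qed
    moreover have "\<sigma> ` ?I \<subseteq> ?I"
    proof clarify
      fix i assume "i \<in> ?I"
      then show "\<sigma> i \<in> ?I" using range[of i] zero by (cases "i = 0") auto
    qed
    \<comment> \<open>An injective self-map of a finite set is onto.\<close>
    ultimately have "bij_betw \<sigma> ?I ?I"
      by (simp add: bij_betw_def endo_inj_surj)
    then have "\<sigma> permutes ?I" by (rule bij_imp_permutes) (simp add: \<sigma>_def)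
    then have "\<sigma> \<in> signed_perms n" by (simp add: signed_perms_def odd)
    moreover have "word_of n \<sigma> = xs"
      by (rule nth_equalityI) (auto simp: word_of_def len \<sigma>_def nat_add_distrib simp del: upt_Suc)
    ultimately show "xs \<in> word_of n ` signed_perms n" by blast
  qed
qed

lemma bij_betw_filter:
  assumes "bij_betw f A B" and "\<And>x. x \<in> A \<Longrightarrow> P x \<longleftrightarrow> Q (f x)"
  shows "bij_betw f {x \<in> A. P x} {y \<in> B. Q y}"
  using assms by (auto simp: bij_betw_def inj_on_def)

lemma B_num_eq_word_count: "B_num n k j = word_count n k j"
  unfolding B_num_def word_count_def
  by (rule bij_betw_same_card, rule bij_betw_filter[OF bij_betw_word_of])
    (simp add: signed_des_word_of signed_neg_word_of)

section \<open>Words without or with only negative entries, and Eulerian numbers\<close>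

definition pos_words :: "nat \<Rightarrow> int list set" where
  "pos_words n = {xs. distinct xs \<and> set xs = {1..int n}}"

lemma bij_betw_pos_words:
  "bij_betw (\<lambda>\<tau>. map (\<lambda>i. int (\<tau> i)) [1..<Suc n]) {\<tau>. \<tau> permutes {1..n}} (pos_words n)"
proof (rule bij_betw_imageI)
  let ?f = "\<lambda>\<tau>. map (\<lambda>i. int (\<tau> i)) [1..<Suc n]"
  show "inj_on ?f {\<tau>. \<tau> permutes {1..n}}"
  proof (rule inj_onI, rule ext)
    fix \<sigma> \<tau> i assume *: "\<sigma> \<in> {\<tau>. \<tau> permutes {1..n}}" "\<tau> \<in> {\<tau>. \<tau> permutes {1..n}}" "?f \<sigma> = ?f \<tau>"
    show "\<sigma> i = \<tau> i"
    proof (cases "i \<in> {1..n}")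
      case True
      then show ?thesis using *(3) unfolding map_eq_conv by (auto simp del: upt_Suc)
    qed (use * in \<open>simp add: permutes_not_in\<close>)
  qed
  show "?f ` {\<tau>. \<tau> permutes {1..n}} = pos_words n"
  proof (intro equalityI subsetI)
    fix xs assume "xs \<in> ?f ` {\<tau>. \<tau> permutes {1..n}}"
    then obtain \<tau> where \<tau>: "\<tau> permutes {1..n}" and xs: "xs = ?f \<tau>" by auto
    have "set xs = int ` \<tau> ` {1..n}"
      unfolding xs by (simp add: image_image atLeastLessThanSuc_atLeastAtMost del: upt_Suc)
    also have "\<dots> = {1..int n}"
      unfolding permutes_image[OF \<tau>] by (simp add: image_int_atLeastAtMost)
    finally show "xs \<in> pos_words n"
      using permutes_inj[OF \<tau>] unfolding xs pos_words_def
      by (auto simp: distinct_map inj_def intro!: inj_onI simp del: upt_Suc)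
  next
    fix xs assume "xs \<in> pos_words n"
    then have d: "distinct xs" and s: "set xs = {1..int n}" by (auto simp: pos_words_def)
    then have len: "length xs = n" using distinct_card[OF d] by simp
    define \<tau> where "\<tau> i = (if i \<in> {1..n} then nat (xs ! (i - 1)) else i)" for i
    have nth: "1 \<le> xs ! m" "xs ! m \<le> int n" if "m < n" for m
      using s len that nth_mem[of m xs] by auto
    have "inj_on \<tau> {1..n}"
    proof (rule inj_onI)
      fix i j assume ij: "i \<in> {1..n}" "j \<in> {1..n}" "\<tau> i = \<tau> j"
      then have "i - 1 < n" "j - 1 < n" by auto
      then have "xs ! (i - 1) = xs ! (j - 1)"
        using ij nth(1)[of "i - 1"] nth(1)[of "j - 1"] by (simp add: \<tau>_def eq_nat_nat_iff)
      then have "i - 1 = j - 1"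
        using ij d len by (subst (asm) nth_eq_iff_index_eq) auto
      with ij show "i = j" by auto
    qed
    moreover have "\<tau> ` {1..n} \<subseteq> {1..n}"
    proof clarify
      fix i assume "i \<in> {1..n}"
      moreover from this have "i - 1 < n" by auto
      ultimately show "\<tau> i \<in> {1..n}"
        using nth[of "i - 1"] by (simp add: \<tau>_def nat_le_iff le_nat_iff)
    qed
    ultimately have "bij_betw \<tau> {1..n} {1..n}" by (simp add: bij_betw_def endo_inj_surj)
    then have "\<tau> permutes {1..n}" by (rule bij_imp_permutes) (auto simp: \<tau>_def)
    moreover have "?f \<tau> = xs"
    proof (rule nth_equalityI)
      fix m assume "m < length (?f \<tau>)"
      then have "m < n" by (simp del: upt_Suc)
      then show "?f \<tau> ! m = xs ! m" using nth[of m] by (auto simp: \<tau>_def simp del: upt_Suc)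
    qed (simp add: len)
    ultimately show "xs \<in> ?f ` {\<tau>. \<tau> permutes {1..n}}" by blast
  qed
qed

lemma A_num_eq_card_pos_words: "A_num n k = card {xs \<in> pos_words n. descents xs = k}"
proof -
  have des: "card {i \<in> {1..<n}. \<tau> i > \<tau> (i + 1)} = descents (map (\<lambda>i. int (\<tau> i)) [1..<Suc n])"
    for \<tau> :: "nat \<Rightarrow> nat"
  proof -
    \<comment> \<open>\<open>A_num\<close> records a descent at its left end,
      \<open>descents_map_upt\<close> at its right end.\<close>
    have "Suc ` {i \<in> {1..<n}. \<tau> i > \<tau> (i + 1)} =
        {i \<in> {Suc 1..<Suc n}. int (\<tau> i) < int (\<tau> (i - 1))}" (is "Suc ` ?L = ?R")
    proof (intro equalityI subsetI)
      fix i assume "i \<in> ?R"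
      then show "i \<in> Suc ` ?L" by (intro image_eqI[of _ _ "i - 1"]) auto
    qed auto
    moreover have "card (Suc ` ?L) = card ?L" by (rule card_image) simp
    ultimately show ?thesis unfolding descents_map_upt by (simp only:)
  qed
  have "bij_betw (\<lambda>\<tau>. map (\<lambda>i. int (\<tau> i)) [1..<Suc n])
      {\<tau> \<in> {\<tau>. \<tau> permutes {1..n}}. card {i \<in> {1..<n}. \<tau> i > \<tau> (i + 1)} = k}
      {xs \<in> pos_words n. descents xs = k}"
    by (rule bij_betw_filter[OF bij_betw_pos_words]) (simp only: des)
  then show ?thesis unfolding A_num_def mem_Collect_eq by (rule bij_betw_same_card)
qed

text \<open>Without negative entries, taking absolute values changes nothing.\<close>

lemma signed_words_nonneg: "{xs \<in> signed_words n. neg_count xs = 0} = pos_words n"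
proof (intro equalityI subsetI)
  fix xs assume "xs \<in> {xs \<in> signed_words n. neg_count xs = 0}"
  then have xs: "xs \<in> signed_words n" and "\<forall>x\<in>set xs. \<not> x < 0"
    by (auto simp: neg_count_def filter_empty_conv)
  then have "map abs xs = xs" by (intro map_idI) auto
  then show "xs \<in> pos_words n"
    using xs by (metis (no_types, lifting) mem_Collect_eq pos_words_def set_map signed_words_def)
next
  fix xs assume "xs \<in> pos_words n"
  then have xs: "distinct xs" "set xs = {1..int n}" by (auto simp: pos_words_def)
  then have "map abs xs = xs" by (intro map_idI) auto
  then show "xs \<in> {xs \<in> signed_words n. neg_count xs = 0}"
    using xs by (auto simp: signed_words_def neg_count_def filter_empty_conv simp flip: set_map)
qed

text \<open>Negating all entries preserves absolute values, hence signed words, and exchanges all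
  negative with all positive.\<close>

lemma signed_words_neg:
  "{xs \<in> signed_words n. neg_count xs = n} = map uminus ` pos_words n"
proof -
  have eq: "neg_count xs = n \<longleftrightarrow> neg_count (map uminus xs) = 0" if "xs \<in> signed_words n" for xs
  proof -
    have "neg_count xs = n \<longleftrightarrow> (\<forall>x\<in>set xs. x < 0)"
      unfolding neg_count_def length_signed_words[OF that, symmetric]
      by (metis filter_id_conv length_filter_less less_irrefl)
    also have "\<dots> \<longleftrightarrow> (\<forall>x\<in>set xs. \<not> - x < 0)"
      using abs_signed_words[OF that] by force
    finally show ?thesis by (auto simp: neg_count_def filter_empty_conv)
  qed
  have inv: "map uminus xs \<in> signed_words n \<longleftrightarrow> xs \<in> signed_words n" for xs
  proof -
    have "map abs (map uminus xs) = map abs xs" by simp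
    then show ?thesis unfolding signed_words_def mem_Collect_eq set_map[symmetric] by metis
  qed
  have "xs \<in> {xs \<in> signed_words n. neg_count xs = n} \<longleftrightarrow> map uminus xs \<in> pos_words n" for xs
    using eq inv by (auto simp flip: signed_words_nonneg)
  \<comment> \<open>Negation is an involution, so the preimage just found is also the image.\<close>
  moreover have "map uminus (map uminus xs) = xs" for xs :: "int list" by (simp add: o_def)
  ultimately show ?thesis by (metis (no_types, lifting) image_iff set_eqI)
qed

text \<open>The leading 0 lies below every positive entry and so starts no descent.\<close>

lemma word_count_no_neg: "word_count n k 0 = A_num n k"
proof -
  have "descents (0 # xs) = descents xs" if "xs \<in> pos_words n" for xs
  proof -
    have "\<forall>x\<in>set xs. 0 < x" using that by (auto simp: pos_words_def)
    then show ?thesis by (cases xs) auto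
  qed
  then have "{xs \<in> pos_words n. descents xs = k} = {xs \<in> pos_words n. descents (0 # xs) = k}"
    by auto
  then show ?thesis
    unfolding word_count_def A_num_eq_card_pos_words signed_words_nonneg[symmetric]
    by (auto intro!: arg_cong[where f = card])
qed

text \<open>After negation the step from 0 to the first entry, if there is one, is a descent, which
  makes up for the missing pair in \<open>descents_map_uminus\<close>. With
  \<open>k \<le> n\<close>, having \<open>k\<close> descents then means \<open>n - k\<close> before
  negation.\<close>

lemma word_count_all_neg:
  assumes "k \<le> n"
  shows "word_count n k n = A_num n (n - k)"
proof -
  have des: "descents (0 # map uminus xs) = n - descents xs \<and> descents xs \<le> n"
    if "xs \<in> pos_words n" for xs
  proof -
    have d: "distinct xs" and s: "set xs = {1..int n}" using that by (auto simp: pos_words_def)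
    have "length xs = n" using distinct_card[OF d] s by simp
    moreover have "\<forall>x\<in>set xs. 0 < x" using s by auto
    ultimately show ?thesis using descents_map_uminus[OF d] by (cases xs) auto
  qed
  have "{xs \<in> signed_words n. descents (0 # xs) = k \<and> neg_count xs = n} =
      {xs \<in> {xs \<in> signed_words n. neg_count xs = n}. descents (0 # xs) = k}" by auto
  also have "\<dots> = map uminus ` {xs \<in> pos_words n. descents xs = n - k}"
    unfolding signed_words_neg using des assms by auto
  finally show ?thesis
    unfolding word_count_def A_num_eq_card_pos_words
    by (simp add: card_image inj_on_def inj_map_eq_map)
qed

section \<open>The recurrence with extended indices and the boundary values\<close>

text \<open>At \<open>m + 1\<close> the zero convention agrees with the true count by
  \<open>word_count_eq_0\<close>; only index -1 needs a case distinction, the one already present in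
  \<open>word_count_Suc\<close>.\<close>

lemma B_ext_eq_word_count:
  "B_ext m (int k) (int j) = word_count m k j"
  "B_ext m (int k - 1) (int j) = (if k = 0 then 0 else word_count m (k - 1) j)"
  "B_ext m (int k) (int j - 1) = (if j = 0 then 0 else word_count m k (j - 1))"
  "B_ext m (int k - 1) (int j - 1) =
     (if k = 0 \<or> j = 0 then 0 else word_count m (k - 1) (j - 1))"
  by (auto simp: B_ext_def B_num_eq_word_count nat_diff_distrib intro!: word_count_eq_0)

theorem theorem2p1:
  shows "(\<forall>n k j :: nat. 1 \<le> n \<and> 0 < k \<and> k < n \<and> 0 < j \<and> j < n \<longrightarrow>
            B_num n k j = (k + 1) * B_num (n - 1) k j
                        + (n - k) * B_num (n - 1) (k - 1) j
                        + k * B_num (n - 1) k (j - 1)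
                        + (n - k + 1) * B_num (n - 1) (k - 1) (j - 1))
       \<and> (\<forall>n k j :: nat. k \<le> n \<and> j \<le> n \<longrightarrow>
            B_num n 0 j = of_bool (j = 0)
          \<and> B_num n n j = of_bool (j = n)
          \<and> B_num n k 0 = A_num n k
          \<and> B_num n k n = A_num n (n - k))
       \<and> (\<forall>n k j :: nat. 1 \<le> n \<and> k \<le> n \<and> j \<le> n \<longrightarrow>
            B_num n k j = (k + 1) * B_ext (n - 1) (int k) (int j)
                        + (n - k) * B_ext (n - 1) (int k - 1) (int j)
                        + k * B_ext (n - 1) (int k) (int j - 1)
                        + (n - k + 1) * B_ext (n - 1) (int k - 1) (int j - 1))"
proof (intro conjI allI impI)
  fix n k j :: nat
  assume "1 \<le> n \<and> 0 < k \<and> k < n \<and> 0 < j \<and> j < n"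
  then show "B_num n k j = (k + 1) * B_num (n - 1) k j + (n - k) * B_num (n - 1) (k - 1) j
      + k * B_num (n - 1) k (j - 1) + (n - k + 1) * B_num (n - 1) (k - 1) (j - 1)"
    using word_count_Suc[of "n - 1" k j] by (simp add: B_num_eq_word_count)
next
  fix n k j :: nat
  assume "1 \<le> n \<and> k \<le> n \<and> j \<le> n"
  then show "B_num n k j = (k + 1) * B_ext (n - 1) (int k) (int j)
      + (n - k) * B_ext (n - 1) (int k - 1) (int j) + k * B_ext (n - 1) (int k) (int j - 1)
      + (n - k + 1) * B_ext (n - 1) (int k - 1) (int j - 1)"
    using word_count_Suc[of "n - 1" k j]
    unfolding B_ext_eq_word_count B_num_eq_word_count by simp
qed (simp_all add: B_num_eq_word_count word_count_no_descents word_count_all_descents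
      word_count_no_neg word_count_all_neg)

end
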